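(* Let $d\ge 1$ be an integer and $k\in\{0,1,\ldots,d\}$. For any function $f:\mathbb{R}^d\to\overline{\mathbb{R}}$, we have the lower bound $$\sup_{y\in\mathbb{R}^d}\Big(-(n\rhd f)^{\star}(y)-\|y\|^{\mathrm{sgn}}_{(k)}\Big)\;\le\;\inf_{\ell_0(x)\le k}f(x),$$ where the problem on the left consists in the maximization of an upper semicontinuous concave function. If, in addition, the convex lower semicontinuous function $(n\rhd f)^{\star}$ is proper, then $$\min_{\|x\|^{\mathrm{sn}}_{(k)}\le 1}(n\rhd f)^{\star\star'}(x)=\sup_{y\in\mathbb{R}^d}\Big(-(n\rhd f)^{\star}(y)-\|y\|^{\mathrm{sgn}}_{(k)}\Big)\;\le\;\inf_{\ell_0(x)\le k}f(x),$$ where the problem on the left consists in the minimization of a lower semicontinuous convex function on the unit ball of the $k$-support norm, and the minimum is attained.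
   Context: $\mathbb{R}^d$ is equipped with the Euclidean scalar product $\langle\cdot,\cdot\rangle$ and Euclidean norm $\|\cdot\|$; $\overline{\mathbb{R}}=[-\infty,+\infty]$. The $\ell_0$ pseudonorm is $\ell_0(x)=|\{j\in\{1,\ldots,d\}: x_j\neq 0\}|$. Normalization mapping: $n:\mathbb{R}^d\to S\cup\{0\}$, $S=\{x:\|x\|=1\}$, $n(x)=x/\|x\|$ if $x\ne 0$ and $n(0)=0$. Infimal postcomposition: $(n\rhd f)(x)=\inf\{f(x'): x'\in\mathbb{R}^d,\ n(x')=x\}$ with $\inf\emptyset=+\infty$; i.e. $(n\rhd f)(x)=\inf_{\lambda>0}f(\lambda x)$ if $x\in S\cup\{0\}$ and $+\infty$ otherwise. Fenchel conjugate: $g^{\star}(y)=\sup_{x}\big(\langle x,y\rangle\underset{\cdot}{+}(-g(x))\big)$; biconjugate: $g^{\star\star'}(x)=\sup_{y}\big(\langle x,y\rangle\underset{\cdot}{+}(-g^{\star}(y))\big)$, where $\underset{\cdot}{+}$ is the addition on $\overline{\mathbb{R}}$ with the convention $(+\infty)\underset{\cdot}{+}(-\infty)=-\infty$. Proper means never $-\infty$ and not identically $+\infty$. For $K\subset\{1,\ldots,d\}$, $x_K$ is the vector coinciding with $x$ on the components in $K$ and vanishing outside $K$. For $k\in\{1,\ldots,d\}$, the $2$-$k$-symmetric gauge norm is $\|x\|^{\mathrm{sgn}}_{(k)}=\sup_{|K|\le k}\|x_K\|$, and the $k$-support norm $\|\cdot\|^{\mathrm{sn}}_{(k)}$ is its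 dual norm, $\|x\|^{\mathrm{sn}}_{(k)}=\sup\{\langle x,y\rangle:\|y\|^{\mathrm{sgn}}_{(k)}\le1\}$. Convention for $k=0$: $\|\cdot\|^{\mathrm{sgn}}_{(0)}=0$, and the set $\{x:\|x\|^{\mathrm{sn}}_{(0)}\le 1\}$ is understood as $\{0\}$ (the closed convex set with support function $0$). *)

theory Defs
  imports "HOL-Analysis.Analysis"
begin

definition l0 :: "real ^ 'n \<Rightarrow> nat" where
  "l0 x = card {j. x $ j \<noteq> 0}"

definition normalization :: "real ^ 'n \<Rightarrow> real ^ 'n" where
  "normalization x = (if x = 0 then 0 else x /\<^sub>R norm x)"

definition inf_postcomp :: "('a \<Rightarrow> 'b) \<Rightarrow> ('a \<Rightarrow> ereal) \<Rightarrow> 'b \<Rightarrow> ereal"  (infixr \<open>\<rhd>\<close> 70) where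
  "(h \<rhd> f) x = (INF x' \<in> {x'. h x' = x}. f x')"

(* The library addition on ereal satisfies \<infinity> + (- \<infinity>) = \<infinity>; the Fenchel conjugate uses the
   opposite convention. *)
definition lower_add :: "ereal \<Rightarrow> ereal \<Rightarrow> ereal"  (infixl \<open>+\<^sub>l\<close> 65) where
  "a +\<^sub>l b = (if a = -\<infinity> \<or> b = -\<infinity> then -\<infinity> else a + b)"

definition fenchel_conj :: "('a::real_inner \<Rightarrow> ereal) \<Rightarrow> 'a \<Rightarrow> ereal" where
  "fenchel_conj g y = (SUP x. ereal (x \<bullet> y) +\<^sub>l - g x)"

definition fenchel_biconj :: "('a::real_inner \<Rightarrow> ereal) \<Rightarrow> 'a \<Rightarrow> ereal" where
  "fenchel_biconj g x = (SUP y. ereal (x \<bullet> y) +\<^sub>l - fenchel_conj g y)"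

definition proper_fun :: "('a \<Rightarrow> ereal) \<Rightarrow> bool" where
  "proper_fun g \<longleftrightarrow> (\<forall>x. g x \<noteq> -\<infinity>) \<and> (\<exists>x. g x \<noteq> \<infinity>)"

(* convex_on and epigraph of the library are restricted to real-valued functions. *)
definition convex_fun :: "('a::real_vector \<Rightarrow> ereal) \<Rightarrow> bool" where
  "convex_fun g \<longleftrightarrow> convex {(x, r :: real). g x \<le> ereal r}"

definition concave_fun :: "('a::real_vector \<Rightarrow> ereal) \<Rightarrow> bool" where
  "concave_fun g \<longleftrightarrow> convex_fun (\<lambda>x. - g x)"

definition lsc_fun :: "('a::topological_space \<Rightarrow> ereal) \<Rightarrow> bool" where
  "lsc_fun g \<longleftrightarrow> (\<forall>t. open {x. t < g x})"

definition usc_fun :: "('a::topological_space \<Rightarrow> ereal) \<Rightarrow> bool" where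
  "usc_fun g \<longleftrightarrow> (\<forall>t. open {x. g x < t})"

definition restr :: "'n set \<Rightarrow> real ^ 'n \<Rightarrow> real ^ 'n" where
  "restr K x = (\<chi> i. if i \<in> K then x $ i else 0)"

definition sgn_norm :: "nat \<Rightarrow> real ^ 'n \<Rightarrow> real" where
  "sgn_norm k x = (SUP K \<in> {K. card K \<le> k}. norm (restr K x))"

(* Meaningful for k \<ge> 1 only: for k = 0 the supremum is over an unbounded set, unless x = 0. *)
definition ksupport_norm :: "nat \<Rightarrow> real ^ 'n \<Rightarrow> real" where
  "ksupport_norm k x = (SUP y \<in> {y. sgn_norm k y \<le> 1}. x \<bullet> y)"

definition ksupport_ball :: "nat \<Rightarrow> (real ^ 'n) set" where
  "ksupport_ball k = (if k = 0 then {0} else {x. ksupport_norm k x \<le> 1})"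

lemma sgn_norm_0: "sgn_norm 0 (x :: real ^ 'n) = 0"
proof -
  have "{K :: 'n set. card K \<le> 0} = {{}}" by auto
  moreover have "restr {} x = 0" by (simp add: restr_def vec_eq_iff)
  ultimately show ?thesis by (simp add: sgn_norm_def)
qed

lemma norm_restr_le_sgn_norm:
  fixes x :: "real ^ 'n"
  assumes "card K \<le> k"
  shows "norm (restr K x) \<le> sgn_norm k x"
  unfolding sgn_norm_def by (rule cSUP_upper) (use assms in auto)

lemma ksupport_norm_bdd_above:
  fixes x :: "real ^ 'n"
  assumes "k \<ge> 1"
  shows "bdd_above ((\<lambda>y. x \<bullet> y) ` {y. sgn_norm k y \<le> 1})"
proof (rule bdd_aboveI2)
  fix y :: "real ^ 'n" assume y: "y \<in> {y. sgn_norm k y \<le> 1}"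
  have le: "\<bar>y $ i\<bar> \<le> 1" for i
  proof -
    have "\<bar>y $ i\<bar> = \<bar>restr {i} y $ i\<bar>" by (simp add: restr_def)
    also have "\<dots> \<le> norm (restr {i} y)" by (rule component_le_norm_cart)
    also have "\<dots> \<le> sgn_norm k y" by (rule norm_restr_le_sgn_norm) (use assms in simp)
    finally show ?thesis using y by simp
  qed
  have "x $ i * y $ i \<le> \<bar>x $ i\<bar>" for i
  proof -
    have "x $ i * y $ i \<le> \<bar>x $ i\<bar> * \<bar>y $ i\<bar>" by (metis abs_ge_self abs_mult)
    also have "\<dots> \<le> \<bar>x $ i\<bar>" using le[of i] by (simp add: mult_left_le)
    finally show ?thesis .
  qed
  then show "x \<bullet> y \<le> (\<Sum>i\<in>UNIV. \<bar>x $ i\<bar>)" by (simp add: inner_vec_def sum_mono)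
qed

end

theory Submission
  imports Defs
begin

text \<open>
  Write h for the conjugate of the postcomposition and s for the symmetric gauge norm. If x has at
  most k nonzero entries, then its normalization u satisfies \<open>u \<bullet> y \<ge> - s y\<close> for all y by
  Cauchy-Schwarz on the support of x; together with \<open>u \<bullet> y - f x \<le> h y\<close> this is the lower bound.

  For the equality, the unit ball of the k-support norm is the set of all x with \<open>x \<bullet> y \<le> s y\<close> for all
  y. If the dual value m is finite, the concave function \<open>- s\<close> lies below the convex function \<open>h + m\<close>,
  so a hyperplane separates the two graphs. It is not vertical because s is finite, and it may be taken
  through the origin because s is sublinear. Its slope lies in the ball and the biconjugate there is
  at most m.
\<close>

section \<open>Convexity and semicontinuity of conjugates\<close>

lemma lower_add_ereal: "ereal a +\<^sub>l b = ereal a + b"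
  by (cases b) (auto simp: lower_add_def)

text \<open>Each term is a continuous real function or a constant infinity, so the strict superlevel
  sets of the supremum are unions of open sets. A general \<phi> leaves room for the gauge norm that
  the dual objective adds to the inner product.\<close>

lemma lsc_SUP_minus_const:
  fixes \<phi> :: "'i \<Rightarrow> 'a::topological_space \<Rightarrow> real" and c :: "'i \<Rightarrow> ereal"
  assumes "\<And>i. continuous_on UNIV (\<phi> i)"
  shows "lsc_fun (\<lambda>y. SUP i. ereal (\<phi> i y) + - c i)"
  unfolding lsc_fun_def
proof
  fix t :: ereal
  have "open {y. t < ereal (\<phi> i y) + - c i}" for i
  proof (cases "c i")
    case (real r)
    have "open {y. t < ereal (\<phi> i y - r)}"
      using assms[of i] by (intro open_Collect_less continuous_intros) auto
    then show ?thesis by (simp add: real)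
  qed auto
  then have "open (\<Union>i. {y. t < ereal (\<phi> i y) + - c i})" by blast
  moreover have "{y. t < (SUP i. ereal (\<phi> i y) + - c i)} = (\<Union>i. {y. t < ereal (\<phi> i y) + - c i})"
    by (auto simp: less_SUP_iff)
  ultimately show "open {y. t < (SUP i. ereal (\<phi> i y) + - c i)}" by simp
qed

text \<open>The epigraph of a supremum is the intersection of the epigraphs; an infinite
  \<open>c i\<close> contributes the empty set or the whole space.\<close>

lemma convex_SUP_minus_const:
  fixes \<phi> :: "'i \<Rightarrow> 'a::real_vector \<Rightarrow> real" and c :: "'i \<Rightarrow> ereal"
  assumes "\<And>i. convex_on UNIV (\<phi> i)"
  shows "convex_fun (\<lambda>y. SUP i. ereal (\<phi> i y) + - c i)"
  unfolding convex_fun_def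
proof -
  have "convex {(y, r). ereal (\<phi> i y) + - c i \<le> ereal r}" for i
  proof (cases "c i")
    case (real q)
    have eq: "{(y, r). ereal (\<phi> i y) + - c i \<le> ereal r} = {(y, r). \<phi> i y - q \<le> r}"
      by (simp add: real)
    show ?thesis unfolding eq convex_def
    proof (clarsimp)
      fix x y :: 'a and a b u v :: real
      assume h: "\<phi> i x - q \<le> a" "\<phi> i y - q \<le> b" and uv: "0 \<le> u" "0 \<le> v" "u + v = 1"
      have "\<phi> i (u *\<^sub>R x + v *\<^sub>R y) \<le> u * \<phi> i x + v * \<phi> i y"
        using assms[of i] uv by (simp add: convex_on_def)
      also have "\<dots> \<le> u * (a + q) + v * (b + q)"
        using h uv by (intro add_mono mult_left_mono) auto
      also have "\<dots> = u * a + v * b + (u + v) * q" by (simp add: algebra_simps)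
      finally show "\<phi> i (u *\<^sub>R x + v *\<^sub>R y) - q \<le> u * a + v * b" using uv by simp
    qed
  qed auto
  then have "convex (\<Inter>i. {(y, r). ereal (\<phi> i y) + - c i \<le> ereal r})" by (intro convex_INT) auto
  moreover have "{(y, r). (SUP i. ereal (\<phi> i y) + - c i) \<le> ereal r}
      = (\<Inter>i. {(y, r). ereal (\<phi> i y) + - c i \<le> ereal r})"
    by (auto simp: SUP_le_iff)
  ultimately show "convex {(y, r). (SUP i. ereal (\<phi> i y) + - c i) \<le> ereal r}" by simp
qed

lemma convex_on_inner: "convex_on UNIV (\<lambda>y::'a::real_inner. x \<bullet> y)"
  by (auto simp: convex_on_def inner_add_right)

text \<open>A real first summand never meets an opposite infinity, so both conventions for addition
  agree here.\<close>

lemma fenchel_conj_eq_SUP: "fenchel_conj g = (\<lambda>y. SUP x. ereal (x \<bullet> y) + - g x)"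
  by (simp add: fenchel_conj_def lower_add_ereal fun_eq_iff)

lemma lsc_fenchel_conj: "lsc_fun (fenchel_conj g)"
  unfolding fenchel_conj_eq_SUP by (intro lsc_SUP_minus_const continuous_intros)

lemma convex_fenchel_conj: "convex_fun (fenchel_conj g)"
  unfolding fenchel_conj_eq_SUP by (intro convex_SUP_minus_const convex_on_inner)

lemma fenchel_biconj_eq: "fenchel_biconj g = fenchel_conj (fenchel_conj g)"
  by (simp add: fenchel_biconj_def fenchel_conj_def[of "fenchel_conj g"] inner_commute fun_eq_iff)

text \<open>A finite summand moves inside the supremum; this brings the negated dual objective into
  the form covered by the two lemmas on suprema.\<close>

lemma fenchel_conj_add_eq_SUP:
  "fenchel_conj g y + ereal (s y) = (SUP x. ereal (x \<bullet> y + s y) + - g x)"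
proof -
  have "fenchel_conj g y + ereal (s y) = (SUP x. (ereal (x \<bullet> y) + - g x) + ereal (s y))"
    by (simp add: fenchel_conj_eq_SUP SUP_ereal_add_left)
  also have "\<dots> = (SUP x. ereal (x \<bullet> y + s y) + - g x)"
    by (simp add: add.assoc add.commute add.left_commute flip: plus_ereal.simps(1))
  finally show ?thesis .
qed

lemma lsc_fenchel_conj_add:
  assumes "continuous_on UNIV s"
  shows "lsc_fun (\<lambda>y. fenchel_conj g y + ereal (s y))"
  unfolding fenchel_conj_add_eq_SUP by (intro lsc_SUP_minus_const continuous_intros assms)

lemma convex_fenchel_conj_add:
  assumes "convex_on UNIV s"
  shows "convex_fun (\<lambda>y. fenchel_conj g y + ereal (s y))"
  unfolding fenchel_conj_add_eq_SUP by (intro convex_SUP_minus_const convex_on_add convex_on_inner assms)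

lemma uminus_diff_ereal: "- a - ereal r = - (a + ereal r)"
  by (cases a) auto

lemma usc_uminus: "lsc_fun g \<Longrightarrow> usc_fun (\<lambda>y. - g y)"
  unfolding lsc_fun_def usc_fun_def by (metis (no_types, lifting) Collect_cong ereal_uminus_less_reorder)

section \<open>The symmetric gauge norm and its dual ball\<close>

lemma restr_lin: "restr K (u *\<^sub>R x + v *\<^sub>R y) = u *\<^sub>R restr K x + v *\<^sub>R restr K y"
  by (simp add: restr_def vec_eq_iff)

lemma sgn_norm_least:
  fixes x :: "real ^ 'n"
  assumes "\<And>K. card K \<le> k \<Longrightarrow> norm (restr K x) \<le> b"
  shows "sgn_norm k x \<le> b"
  unfolding sgn_norm_def by (rule cSUP_least) (use assms in \<open>auto intro: exI[of _ "{}"]\<close>)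

lemma sgn_norm_nonneg: "0 \<le> sgn_norm k x"
  using norm_restr_le_sgn_norm[of "{}" k x] norm_ge_zero[of "restr {} x"] by (simp del: norm_ge_zero)

lemma sgn_norm_scaleR_le:
  fixes x :: "real ^ 'n"
  shows "sgn_norm k (c *\<^sub>R x) \<le> \<bar>c\<bar> * sgn_norm k x"
proof (rule sgn_norm_least)
  fix K :: "'n set" assume "card K \<le> k"
  then have "\<bar>c\<bar> * norm (restr K x) \<le> \<bar>c\<bar> * sgn_norm k x"
    by (intro mult_left_mono norm_restr_le_sgn_norm) auto
  then show "norm (restr K (c *\<^sub>R x)) \<le> \<bar>c\<bar> * sgn_norm k x"
    using restr_lin[of K c x 0 0] by simp
qed

lemma sgn_norm_uminus_le: "sgn_norm k (- x) \<le> sgn_norm k x"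
  using sgn_norm_scaleR_le[of k "-1" x] by simp

lemma convex_on_sgn_norm: "convex_on UNIV (sgn_norm k :: real ^ 'n \<Rightarrow> real)"
proof (rule convex_onI)
  fix t :: real and x y :: "real ^ 'n"
  assume t: "0 < t" "t < 1"
  show "sgn_norm k ((1 - t) *\<^sub>R x + t *\<^sub>R y) \<le> (1 - t) * sgn_norm k x + t * sgn_norm k y"
  proof (rule sgn_norm_least)
    fix K :: "'n set" assume K: "card K \<le> k"
    have "norm (restr K ((1 - t) *\<^sub>R x + t *\<^sub>R y))
        \<le> norm ((1 - t) *\<^sub>R restr K x) + norm (t *\<^sub>R restr K y)"
      unfolding restr_lin by (rule norm_triangle_ineq)
    also have "\<dots> = (1 - t) * norm (restr K x) + t * norm (restr K y)" using t by simp
    also have "\<dots> \<le> (1 - t) * sgn_norm k x + t * sgn_norm k y"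
      using t K by (intro add_mono mult_left_mono norm_restr_le_sgn_norm) auto
    finally show "norm (restr K ((1 - t) *\<^sub>R x + t *\<^sub>R y)) \<le> (1 - t) * sgn_norm k x + t * sgn_norm k y" .
  qed
qed auto

lemma continuous_on_sgn_norm: "continuous_on UNIV (sgn_norm k :: real ^ 'n \<Rightarrow> real)"
  by (rule convex_on_continuous[OF open_UNIV convex_on_sgn_norm])

text \<open>Singletons are admissible index sets once k \<ge> 1, so the gauge norm dominates every
  coordinate. This permits division by the gauge norm of a nonzero vector.\<close>

lemma sgn_norm_le_0D:
  fixes y :: "real ^ 'n"
  assumes "k \<ge> 1" "sgn_norm k y \<le> 0"
  shows "y = 0"
proof -
  have "y $ i = 0" for i
  proof -
    have "\<bar>restr {i} y $ i\<bar> \<le> norm (restr {i} y)" by (rule component_le_norm_cart)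
    also have "\<dots> \<le> sgn_norm k y" using assms by (intro norm_restr_le_sgn_norm) simp
    finally show ?thesis using assms by (simp add: restr_def)
  qed
  then show ?thesis by (simp add: vec_eq_iff)
qed

text \<open>A description by linear inequalities that is uniform in k: for k = 0 it leaves only the
  origin, for k \<ge> 1 it is the dual norm inequality.\<close>

lemma mem_ksupport_ball_iff:
  fixes x :: "real ^ 'n"
  shows "x \<in> ksupport_ball k \<longleftrightarrow> (\<forall>y. x \<bullet> y \<le> sgn_norm k y)"
proof (cases "k = 0")
  case True
  have "x = 0" if "\<forall>y. x \<bullet> y \<le> 0"
    using that[rule_format, of x] by (metis inner_eq_zero_iff inner_ge_zero order_antisym)
  then show ?thesis using True by (auto simp: ksupport_ball_def sgn_norm_0)
next
  case False
  then have k: "k \<ge> 1" by simp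
  have "x \<bullet> y \<le> sgn_norm k y" if x: "ksupport_norm k x \<le> 1" for y
  proof (cases "sgn_norm k y = 0")
    case True
    then have "y = 0" using sgn_norm_le_0D[OF k, of y] by simp
    then show ?thesis by (simp add: sgn_norm_nonneg)
  next
    case False
    then have pos: "0 < sgn_norm k y" using sgn_norm_nonneg[of k y] by simp
    \<comment> \<open>The rescaled y is a competitor in the supremum that defines the dual
      norm.\<close>
    have "sgn_norm k (inverse (sgn_norm k y) *\<^sub>R y) \<le> 1"
      using sgn_norm_scaleR_le[of k "inverse (sgn_norm k y)" y] pos by simp
    then have "x \<bullet> (inverse (sgn_norm k y) *\<^sub>R y) \<le> ksupport_norm k x"
      unfolding ksupport_norm_def by (intro cSUP_upper ksupport_norm_bdd_above k) auto
    then have "(x \<bullet> y) / sgn_norm k y \<le> 1" using x by (simp add: field_simps)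
    then show ?thesis using pos by (simp add: field_simps)
  qed
  moreover have "ksupport_norm k x \<le> 1" if "\<forall>y. x \<bullet> y \<le> sgn_norm k y"
    unfolding ksupport_norm_def
  proof (rule cSUP_least)
    have "sgn_norm k (0 :: real ^ 'n) \<le> 1" using sgn_norm_scaleR_le[of k 0 "0 :: real ^ 'n"] by simp
    then show "{y :: real ^ 'n. sgn_norm k y \<le> 1} \<noteq> {}" by blast
  qed (use that in \<open>auto intro: order_trans\<close>)
  ultimately show ?thesis using False by (auto simp: ksupport_ball_def)
qed

section \<open>The lower bound\<close>

lemma norm_normalization_le: "norm (normalization x) \<le> 1"
  by (simp add: normalization_def)

lemma inner_normalization_ge:
  fixes x y :: "real ^ 'n"
  assumes "l0 x \<le> k"
  shows "- sgn_norm k y \<le> normalization x \<bullet> y"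
proof -
  let ?K = "{j. x $ j \<noteq> 0}"
  \<comment> \<open>Off the support of x the normalization vanishes, so only the entries of y on
    that support count.\<close>
  have "normalization x \<bullet> y = normalization x \<bullet> restr ?K y"
    by (auto simp: inner_vec_def restr_def normalization_def intro!: sum.cong)
  then have "\<bar>normalization x \<bullet> y\<bar> \<le> norm (normalization x) * norm (restr ?K y)"
    by (simp add: Cauchy_Schwarz_ineq2)
  also have "\<dots> \<le> 1 * sgn_norm k y"
    using assms by (intro mult_mono norm_normalization_le norm_restr_le_sgn_norm) (auto simp: l0_def)
  finally show ?thesis by simp
qed

text \<open>Since x itself competes in the infimum that defines the postcomposition at its
  normalization, the Fenchel inequality there applies with \<open>f x\<close>.\<close>

lemma dual_le_primal:
  fixes f :: "real ^ 'n \<Rightarrow> ereal"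
  assumes "l0 x \<le> k"
  shows "- fenchel_conj (normalization \<rhd> f) y - ereal (sgn_norm k y) \<le> f x"
proof -
  let ?u = "normalization x" and ?h = "fenchel_conj (normalization \<rhd> f) y"
  have "(normalization \<rhd> f) ?u \<le> f x" unfolding inf_postcomp_def by (rule INF_lower) simp
  then have "ereal (?u \<bullet> y) + - f x \<le> ereal (?u \<bullet> y) + - (normalization \<rhd> f) ?u"
    by (intro add_left_mono) simp
  also have "\<dots> \<le> ?h" unfolding fenchel_conj_eq_SUP by (rule SUP_upper) simp
  finally have "ereal (?u \<bullet> y) + - f x \<le> ?h" .
  \<comment> \<open>If \<open>f x\<close> is minus infinity, then \<open>?h\<close> is plus infinity
    and the left side is minus infinity too.\<close>
  then show ?thesis using inner_normalization_ge[OF assms, of y]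
    by (cases "f x"; cases ?h) auto
qed

section \<open>A linear function between a concave and a convex one\<close>

lemma convex_sublinear_sandwich:
  fixes h :: "'a::euclidean_space \<Rightarrow> ereal" and s :: "'a \<Rightarrow> real"
  assumes h: "convex_fun h" "h y0 \<noteq> \<infinity>"
    and s: "convex_on UNIV s" "\<And>t y. 0 \<le> t \<Longrightarrow> s (t *\<^sub>R y) \<le> t * s y"
    and le: "\<And>y. ereal (- s y - m) \<le> h y"
  obtains x where "\<And>y. - s y \<le> x \<bullet> y" "\<And>y. ereal (x \<bullet> y - m) \<le> h y"
proof -
  define C where "C = {(y, r). h y \<le> ereal r}"
  \<comment> \<open>The strict inequality keeps D disjoint from the epigraph C even where the two
    graphs touch.\<close>
  define D where "D = {(y, r). r < - s y - m}"
  have "convex C" using h by (simp add: C_def convex_fun_def)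
  moreover have "convex D" unfolding convex_def D_def
  proof (clarsimp)
    fix x y a b and u v :: real
    assume ab: "a < - s x - m" "b < - s y - m" and uv: "0 \<le> u" "0 \<le> v" "u + v = 1"
    have "u * a + v * b < u * (- s x - m) + v * (- s y - m)"
    proof (cases "u = 0")
      case False
      then show ?thesis using ab uv by (intro add_less_le_mono mult_strict_left_mono mult_left_mono) auto
    qed (use ab uv in auto)
    also have "\<dots> = - (u * s x + v * s y) - (u + v) * m" by (simp add: algebra_simps)
    also have "\<dots> \<le> - s (u *\<^sub>R x + v *\<^sub>R y) - m"
    proof -
      have "s (u *\<^sub>R x + v *\<^sub>R y) \<le> u * s x + v * s y"
        using s(1) uv unfolding convex_on_def by blast
      then show ?thesis using uv by simp
    qed
    finally show "u * a + v * b < - s (u *\<^sub>R x + v *\<^sub>R y) - m" .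
  qed
  moreover have C: "(y, r) \<in> C \<longleftrightarrow> h y \<le> ereal r" for y r by (simp add: C_def)
  have D: "(y, r) \<in> D \<longleftrightarrow> r < - s y - m" for y r by (simp add: D_def)
  obtain r0 where r0: "h y0 = ereal r0" using h(2) le[of y0] by (cases "h y0") auto
  have "(y0, r0) \<in> C" by (simp add: C r0)
  moreover have "(0, - s 0 - m - 1) \<in> D" by (simp add: D)
  moreover have "C \<inter> D = {}"
  proof -
    have False if "h y \<le> ereal r" "r < - s y - m" for y r
      using order_trans[OF le[of y] that(1)] that(2) by simp
    then show ?thesis by (auto simp: C_def D_def)
  qed
  ultimately obtain w \<beta> where w: "w \<noteq> 0" "\<And>p. p \<in> D \<Longrightarrow> w \<bullet> p \<le> \<beta>" "\<And>p. p \<in> C \<Longrightarrow> \<beta> \<le> w \<bullet> p"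
    using separating_hyperplane_sets[of D C] by blast
  obtain a \<alpha> where wa: "w = (a, \<alpha>)" by (cases w)
  have wD: "a \<bullet> y + \<alpha> * r \<le> \<beta>" if "r < - s y - m" for y r
    using w(2)[of "(y, r)"] that by (simp add: D wa)
  have wC: "\<beta> \<le> a \<bullet> y + \<alpha> * r" if "h y \<le> ereal r" for y r
    using w(3)[of "(y, r)"] that by (simp add: C wa)
  \<comment> \<open>D extends downwards without bound over y = 0, so a negative \<alpha> would make
    the functional exceed \<beta> on D.\<close>
  have "\<alpha> \<ge> 0"
  proof (rule ccontr)
    assume "\<not> \<alpha> \<ge> 0"
    define R where "R = min (- s 0 - m - 1) ((\<beta> + 1) / \<alpha>)"
    have "\<beta> + 1 \<le> \<alpha> * R"
    proof -
      have "R \<le> (\<beta> + 1) / \<alpha>" by (simp add: R_def)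
      then show ?thesis using \<open>\<not> \<alpha> \<ge> 0\<close> by (simp add: field_simps)
    qed
    moreover have "R < - s 0 - m" by (simp add: R_def)
    ultimately show False using wD[of R 0] by simp
  qed
  \<comment> \<open>As s is finite, D projects onto the whole space; a vertical hyperplane would
    bound a nonzero linear form from above.\<close>
  moreover have "\<alpha> \<noteq> 0"
  proof
    assume \<alpha>: "\<alpha> = 0"
    then have "a \<noteq> 0" using w(1) wa by (auto simp: zero_prod_def)
    have "a \<bullet> y \<le> \<beta>" for y using wD[of "- s y - m - 1" y] \<alpha> by simp
    from this[of "((\<beta> + 1) / (a \<bullet> a)) *\<^sub>R a"] show False using \<open>a \<noteq> 0\<close> by simp
  qed
  ultimately have pos: "\<alpha> > 0" by simp
  \<comment> \<open>After division by \<alpha> the hyperplane is the graph of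
    \<open>x \<bullet> y + \<gamma> - m\<close>. It remains to remove the offset \<gamma>.\<close>
  define x where "x = - (a /\<^sub>R \<alpha>)"
  define \<gamma> where "\<gamma> = \<beta> / \<alpha> + m"
  have ax: "a \<bullet> y = - \<alpha> * (x \<bullet> y)" for y using pos by (simp add: x_def)
  have \<beta>: "\<beta> = \<alpha> * (\<gamma> - m)" using pos by (simp add: \<gamma>_def)
  have up: "- s y \<le> x \<bullet> y + \<gamma>" for y
  proof (rule ccontr)
    assume "\<not> ?thesis"
    then obtain r where r: "x \<bullet> y + \<gamma> - m < r" "r < - s y - m"
      using dense[of "x \<bullet> y + \<gamma> - m" "- s y - m"] by auto
    have "\<alpha> * (r - x \<bullet> y) \<le> \<alpha> * (\<gamma> - m)"
      using wD[OF r(2)] by (simp add: ax \<beta> algebra_simps)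
    then show False using r pos by simp
  qed
  \<comment> \<open>With \<gamma> nonnegative, dropping it preserves the inequality with h; the one
    with s needs the scaling argument below.\<close>
  have "s 0 \<le> 0" using s(2)[of 0 0] by simp
  with up[of 0] have "\<gamma> \<ge> 0" by simp
  show thesis
  proof
    fix y
    show "ereal (x \<bullet> y - m) \<le> h y"
    proof (cases "h y")
      case (real r)
      have "\<alpha> * (\<gamma> - m) \<le> \<alpha> * (r - x \<bullet> y)"
        using wC[of y r] real by (simp add: ax \<beta> algebra_simps)
      then show ?thesis using pos \<open>\<gamma> \<ge> 0\<close> real by simp
    qed (use le[of y] in auto)
    show "- s y \<le> x \<bullet> y"
    proof (rule ccontr)
      assume neg: "\<not> - s y \<le> x \<bullet> y"
      define \<delta> where "\<delta> = - s y - x \<bullet> y"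
      have \<delta>: "\<delta> > 0" using neg by (simp add: \<delta>_def)
      \<comment> \<open>By \<open>up\<close>, the gap \<open>- s y - x \<bullet> y\<close> never
        exceeds \<gamma>. Scaling y by t multiplies the gap by at least t, and this t lifts it to
        \<gamma> + 1.\<close>
      define t where "t = (\<gamma> + 1) / \<delta>"
      have t: "t \<ge> 0" "t * \<delta> = \<gamma> + 1" using \<delta> \<open>\<gamma> \<ge> 0\<close> by (simp_all add: t_def)
      have "t * \<delta> = - (t * s y) - t * (x \<bullet> y)" by (simp add: \<delta>_def algebra_simps)
      also have "\<dots> \<le> - s (t *\<^sub>R y) - x \<bullet> (t *\<^sub>R y)" using s(2)[OF t(1), of y] by simp
      also have "\<dots> \<le> \<gamma>" using up[of "t *\<^sub>R y"] by simp
      finally show False using t(2) by simp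
    qed
  qed
qed

section \<open>Duality on the unit ball of the k-support norm\<close>

lemma dual_le_fenchel_conj:
  assumes "x \<in> ksupport_ball k"
  shows "(SUP y. - h y - ereal (sgn_norm k y)) \<le> fenchel_conj h x"
proof (rule SUP_least)
  fix y
  \<comment> \<open>Testing ball membership at -y bounds \<open>x \<bullet> y\<close> from below,
    which compares the two suprema term by term.\<close>
  have "x \<bullet> (- y) \<le> sgn_norm k y"
    using assms sgn_norm_uminus_le[of k y] mem_ksupport_ball_iff order_trans by blast
  then have "- h y - ereal (sgn_norm k y) \<le> ereal (y \<bullet> x) + - h y"
    by (cases "h y") (auto simp: inner_commute)
  also have "\<dots> \<le> fenchel_conj h x" unfolding fenchel_conj_eq_SUP by (rule SUP_upper) simp
  finally show "- h y - ereal (sgn_norm k y) \<le> fenchel_conj h x" .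
qed

text \<open>One point yields both the reverse inequality and the minimizer. An infinite dual value
  is handled apart, since the sandwich needs a real offset.\<close>

lemma ex_fenchel_conj_le_dual:
  fixes h :: "real ^ 'n \<Rightarrow> ereal"
  assumes "convex_fun h" "proper_fun h"
  obtains x where "x \<in> ksupport_ball k" "fenchel_conj h x \<le> (SUP y. - h y - ereal (sgn_norm k y))"
proof -
  define M where "M = (SUP y. - h y - ereal (sgn_norm k y))"
  have M: "- h y - ereal (sgn_norm k y) \<le> M" for y unfolding M_def by (rule SUP_upper) simp
  obtain y0 where y0: "h y0 \<noteq> \<infinity>" using assms by (auto simp: proper_fun_def)
  show thesis
  proof (cases M)
    case PInf
    have "(0 :: real ^ 'n) \<in> ksupport_ball k" by (simp add: mem_ksupport_ball_iff sgn_norm_nonneg)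
    then show thesis using that PInf by (simp add: M_def)
  next
    \<comment> \<open>Impossible: at \<open>y0\<close> the dual objective exceeds minus
      infinity.\<close>
    case MInf
    then show thesis using M[of y0] y0 by (cases "h y0") auto
  next
    case (real m)
    have le: "ereal (- sgn_norm k y - m) \<le> h y" for y
      using M[of y] real by (cases "h y") auto
    have sc: "sgn_norm k (t *\<^sub>R y) \<le> t * sgn_norm k y" if "0 \<le> t" for t and y :: "real ^ 'n"
      using sgn_norm_scaleR_le[of k t y] that by simp
    obtain x where x: "\<And>y. - sgn_norm k y \<le> x \<bullet> y" "\<And>y. ereal (x \<bullet> y - m) \<le> h y"
      using convex_sublinear_sandwich[OF assms(1) y0 convex_on_sgn_norm sc le] by blast
    show thesis
    proof (rule that)
      have "x \<bullet> y \<le> sgn_norm k y" for y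
        using x(1)[of "- y"] sgn_norm_uminus_le[of k y] by simp
      then show "x \<in> ksupport_ball k" by (simp add: mem_ksupport_ball_iff)
      \<comment> \<open>The affine minorant \<open>x \<bullet> y - m\<close> of h says precisely
        that the conjugate at x is at most m.\<close>
      have "ereal (y \<bullet> x) + - h y \<le> ereal m" for y
        using x(2)[of y] by (cases "h y") (auto simp: inner_commute)
      then show "fenchel_conj h x \<le> (SUP y. - h y - ereal (sgn_norm k y))"
        unfolding M_def[symmetric] real fenchel_conj_eq_SUP by (intro SUP_least)
    qed
  qed
qed

theorem theorem10:
  fixes f :: "real ^ 'n \<Rightarrow> ereal" and k :: nat
  assumes "k \<le> CARD('n)"
  shows
    "(SUP y. - fenchel_conj (normalization \<rhd> f) y - ereal (sgn_norm k y)) \<le> (INF x \<in> {x. l0 x \<le> k}. f x)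
     \<and> usc_fun (\<lambda>y. - fenchel_conj (normalization \<rhd> f) y - ereal (sgn_norm k y))
     \<and> concave_fun (\<lambda>y. - fenchel_conj (normalization \<rhd> f) y - ereal (sgn_norm k y))
     \<and> convex_fun (fenchel_conj (normalization \<rhd> f))
     \<and> lsc_fun (fenchel_conj (normalization \<rhd> f))
     \<and> (proper_fun (fenchel_conj (normalization \<rhd> f)) \<longrightarrow>
          (INF x \<in> ksupport_ball k. fenchel_biconj (normalization \<rhd> f) x)
            = (SUP y. - fenchel_conj (normalization \<rhd> f) y - ereal (sgn_norm k y))
          \<and> (\<exists>x0 \<in> ksupport_ball k. fenchel_biconj (normalization \<rhd> f) x0
                = (INF x \<in> ksupport_ball k. fenchel_biconj (normalization \<rhd> f) x))
          \<and> (SUP y. - fenchel_conj (normalization \<rhd> f) y - ereal (sgn_norm k y)) \<le> (INF x \<in> {x. l0 x \<le> k}. f x)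
          \<and> lsc_fun (fenchel_biconj (normalization \<rhd> f))
          \<and> convex_fun (fenchel_biconj (normalization \<rhd> f)))"
proof -
  let ?h = "fenchel_conj (normalization \<rhd> f)"
  let ?D = "SUP y. - ?h y - ereal (sgn_norm k y)"
  have weak: "?D \<le> (INF x \<in> {x. l0 x \<le> k}. f x)"
    by (intro SUP_least INF_greatest) (simp add: dual_le_primal)
  have usc: "usc_fun (\<lambda>y. - ?h y - ereal (sgn_norm k y))"
    unfolding uminus_diff_ereal by (intro usc_uminus lsc_fenchel_conj_add continuous_on_sgn_norm)
  have conc: "concave_fun (\<lambda>y. - ?h y - ereal (sgn_norm k y))"
    unfolding uminus_diff_ereal concave_fun_def ereal_uminus_uminus
    by (intro convex_fenchel_conj_add convex_on_sgn_norm)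
  have strong: "(INF x \<in> ksupport_ball k. fenchel_biconj (normalization \<rhd> f) x) = ?D"
      "\<exists>x0 \<in> ksupport_ball k. fenchel_biconj (normalization \<rhd> f) x0
            = (INF x \<in> ksupport_ball k. fenchel_biconj (normalization \<rhd> f) x)"
    if proper: "proper_fun ?h"
  proof -
    obtain x0 where x0: "x0 \<in> ksupport_ball k" "fenchel_conj ?h x0 \<le> ?D"
      using ex_fenchel_conj_le_dual[OF convex_fenchel_conj proper] by blast
    have "?D \<le> (INF x \<in> ksupport_ball k. fenchel_conj ?h x)"
      by (intro INF_greatest dual_le_fenchel_conj)
    moreover have "(INF x \<in> ksupport_ball k. fenchel_conj ?h x) \<le> fenchel_conj ?h x0"
      using x0(1) by (rule INF_lower)
    \<comment> \<open>The chain \<open>?D\<close> \<le> infimum \<le> value at \<open>x0\<close>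
      \<le> \<open>?D\<close> collapses to equalities.\<close>
    ultimately have eq: "(INF x \<in> ksupport_ball k. fenchel_conj ?h x) = ?D"
      and "fenchel_conj ?h x0 = (INF x \<in> ksupport_ball k. fenchel_conj ?h x)"
      using x0(2) by auto
    then show "\<exists>x0 \<in> ksupport_ball k. fenchel_biconj (normalization \<rhd> f) x0
            = (INF x \<in> ksupport_ball k. fenchel_biconj (normalization \<rhd> f) x)"
      unfolding fenchel_biconj_eq using x0(1) by blast
    show "(INF x \<in> ksupport_ball k. fenchel_biconj (normalization \<rhd> f) x) = ?D"
      unfolding fenchel_biconj_eq by (rule eq)
  qed
  have "lsc_fun (fenchel_biconj (normalization \<rhd> f))" "convex_fun (fenchel_biconj (normalization \<rhd> f))"
    unfolding fenchel_biconj_eq by (rule lsc_fenchel_conj convex_fenchel_conj)+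
  then show ?thesis
    by (intro conjI impI weak usc conc convex_fenchel_conj lsc_fenchel_conj strong)
qed

end
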